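(* Let $q\ge 1$ be an integer and $G$ a finite graph with average degree $d(G)=2|E(G)|/|V(G)|$. Then $\mathrm{OPT}_q(G)\ge \frac{d(G)^2}{2q^2}$.
   Context: An edge $q$-coloring of a graph is an assignment of colors to its edges such that each vertex is incident to edges of at most $q$ distinct colors. A color group is the set of all edges receiving a given color. $\mathrm{OPT}_q(G)$ denotes the minimum, over all edge $q$-colorings of $G$, of the size of the largest color group. *)

theory Defs
  imports Complex_Main
begin

text \<open>Finite simple graphs: the edges are two-element subsets of the vertex set, so there are
  no loops and no parallel edges.\<close>

definition finite_simple_graph :: "'a set \<Rightarrow> 'a set set \<Rightarrow> bool" where
  "finite_simple_graph V E \<longleftrightarrow> finite V \<and> (\<forall>e\<in>E. e \<subseteq> V \<and> card e = 2)"

text \<open>If \<open>V\<close> is empty this is 0, as division by 0 yields 0.\<close>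

definition average_degree :: "'a set \<Rightarrow> 'a set set \<Rightarrow> real" where
  "average_degree V E = 2 * real (card E) / real (card V)"

definition edge_q_coloring :: "nat \<Rightarrow> 'a set \<Rightarrow> 'a set set \<Rightarrow> ('a set \<Rightarrow> 'c) \<Rightarrow> bool" where
  "edge_q_coloring q V E f \<longleftrightarrow> (\<forall>v\<in>V. card (f ` {e \<in> E. v \<in> e}) \<le> q)"

definition color_group :: "'a set set \<Rightarrow> ('a set \<Rightarrow> 'c) \<Rightarrow> 'c \<Rightarrow> 'a set set" where
  "color_group E f c = {e \<in> E. f e = c}"

text \<open>The maximum ranges over all colors, including unused ones, whose groups are empty.
  Hence it is 0 for a graph without edges.\<close>

definition largest_color_group :: "'a set set \<Rightarrow> ('a set \<Rightarrow> 'c) \<Rightarrow> nat" where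
  "largest_color_group E f = Max (range (\<lambda>c. card (color_group E f c)))"

text \<open>The colors are natural numbers; by \<open>OPT_le\<close> below, other types of colors give no smaller
  value. The infimum is a minimum if \<open>q \<ge> 1\<close>, see \<open>OPT_attained\<close>.\<close>

definition OPT :: "nat \<Rightarrow> 'a set \<Rightarrow> 'a set set \<Rightarrow> nat" where
  "OPT q V E = Inf {largest_color_group E f | f :: 'a set \<Rightarrow> nat. edge_q_coloring q V E f}"

lemma finite_edges: "finite_simple_graph V E \<Longrightarrow> finite E"
  unfolding finite_simple_graph_def by (rule finite_subset[of _ "Pow V"]) auto

lemma finite_color_group_sizes:
  assumes "finite E"
  shows "finite (range (\<lambda>c. card (color_group E f c)))"
proof (rule finite_subset)
  show "range (\<lambda>c. card (color_group E f c)) \<subseteq> {..card E}"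
    using assms by (auto simp: color_group_def intro!: card_mono)
qed simp

lemma OPT_attained:
  assumes "q \<ge> 1"
  obtains f :: "'a set \<Rightarrow> nat"
  where "edge_q_coloring q V E f" and "largest_color_group E f = OPT q V E"
proof -
  let ?S = "{largest_color_group E f | f :: 'a set \<Rightarrow> nat. edge_q_coloring q V E f}"
  have "card ((\<lambda>_. 0 :: nat) ` {e \<in> E. v \<in> e}) \<le> q" for v
    using assms by (cases "{e \<in> E. v \<in> e} = {}") (auto simp: image_constant_conv)
  then have "edge_q_coloring q V E (\<lambda>_. 0 :: nat)"
    by (simp add: edge_q_coloring_def)
  then have "?S \<noteq> {}" by blast
  then have "Inf ?S \<in> ?S" by (rule Inf_nat_def1)
  then show ?thesis using that unfolding OPT_def by auto
qed

lemma OPT_le: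
  fixes f :: "'a set \<Rightarrow> 'c"
  assumes "finite_simple_graph V E" and "edge_q_coloring q V E f"
  shows "OPT q V E \<le> largest_color_group E f"
proof -
  have fin: "finite E" using assms(1) by (rule finite_edges)
  then obtain g :: "'c \<Rightarrow> nat" where g: "inj_on g (f ` E)"
    using finite_imp_inj_to_nat_seg[of "f ` E"] by blast
  have "card ((g \<circ> f) ` {e \<in> E. v \<in> e}) \<le> q" if "v \<in> V" for v
  proof -
    have "card ((g \<circ> f) ` {e \<in> E. v \<in> e}) \<le> card (f ` {e \<in> E. v \<in> e})"
      unfolding image_comp[symmetric] by (rule card_image_le) (use fin in simp)
    also have "\<dots> \<le> q" using assms(2) that by (simp add: edge_q_coloring_def)
    finally show ?thesis .
  qed
  then have col: "edge_q_coloring q V E (g \<circ> f)"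
    by (simp add: edge_q_coloring_def)
  have "card (color_group E (g \<circ> f) n) \<le> largest_color_group E f" for n
  proof (cases "color_group E (g \<circ> f) n = {}")
    case True
    then show ?thesis by simp
  next
    case False
    then obtain e where "e \<in> E" "g (f e) = n" by (auto simp: color_group_def)
    then have "color_group E (g \<circ> f) n = color_group E f (f e)"
      using g by (auto simp: color_group_def inj_on_def)
    then show ?thesis
      unfolding largest_color_group_def
      using finite_color_group_sizes[OF fin, of f] by (auto intro: Max_ge)
  qed
  then have "largest_color_group E (g \<circ> f) \<le> largest_color_group E f"
    unfolding largest_color_group_def[of E "g \<circ> f"]
    using finite_color_group_sizes[OF fin, of "g \<circ> f"] by (subst Max_le_iff) auto
  moreover have "OPT q V E \<le> largest_color_group E (g \<circ> f)"
    unfolding OPT_def by (rule cInf_lower) (use col in auto)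
  ultimately show ?thesis by simp
qed

end

theory Submission
  imports Defs
begin

text \<open>A color group with \<open>m\<close> edges spanning \<open>n\<close> vertices satisfies \<open>2 m \<le> n\<^sup>2\<close>. If also
  \<open>m \<le> k\<close>, then \<open>2 m\<^sup>2 \<le> k n\<^sup>2\<close>, which is the linear bound \<open>sqrt 2 m \<le> sqrt k n\<close>. Summing over
  all colors, and counting each vertex at most \<open>q\<close> times, gives
  \<open>sqrt 2 \<bar>E\<bar> \<le> sqrt k q \<bar>V\<bar>\<close>.\<close>

text \<open>The members of \<open>F\<close> are among the \<open>card U choose 2\<close> pairs in
  \<open>U\<close>. Weakening \<open>n * (n - 1)\<close> to the square of \<open>n\<close> makes a
  root of the bound linear in \<open>n\<close>.\<close>

lemma two_card_edges_le:
  assumes "finite U" and "\<And>e. e \<in> F \<Longrightarrow> e \<subseteq> U \<and> card e = 2"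
  shows "2 * card F \<le> (card U)\<^sup>2"
proof -
  have "card F \<le> card {e. e \<subseteq> U \<and> card e = 2}"
    using assms by (intro card_mono) auto
  also have "\<dots> = card U choose 2"
    using assms(1) by (rule n_subsets)
  finally have "2 * card F \<le> card U * (card U - 1)"
    by (simp add: choose_two)
  also have "\<dots> \<le> (card U)\<^sup>2"
    by (simp add: power2_eq_square)
  finally show ?thesis .
qed

text \<open>Double counting of the pairs of a vertex and a color that occurs on an edge at this
  vertex.\<close>

lemma sum_card_Union_color_group:
  assumes "finite V" and "finite E" and "\<And>e. e \<in> E \<Longrightarrow> e \<subseteq> V"
  shows "(\<Sum>c\<in>f ` E. card (\<Union>(color_group E f c))) = (\<Sum>v\<in>V. card (f ` {e \<in> E. v \<in> e}))"
proof -
  have "(\<Sum>c\<in>f ` E. card {v \<in> V. \<exists>e\<in>E. f e = c \<and> v \<in> e})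
      = (\<Sum>v\<in>V. card {c \<in> f ` E. \<exists>e\<in>E. f e = c \<and> v \<in> e})"
    using assms(1,2) by (intro sum_multicount_gen) auto
  moreover have "\<Union>(color_group E f c) = {v \<in> V. \<exists>e\<in>E. f e = c \<and> v \<in> e}" for c
    using assms(3) by (auto simp: color_group_def)
  moreover have "f ` {e \<in> E. v \<in> e} = {c \<in> f ` E. \<exists>e\<in>E. f e = c \<and> v \<in> e}" for v
    by (auto intro: rev_image_eqI)
  ultimately show ?thesis by simp
qed

lemma card_edges_le_largest_color_group:
  assumes G: "finite_simple_graph V E" and col: "edge_q_coloring q V E f"
  shows "sqrt 2 * card E \<le> sqrt (largest_color_group E f) * (q * card V)"
proof -
  have finV: "finite V" and edge: "\<And>e. e \<in> E \<Longrightarrow> e \<subseteq> V \<and> card e = 2"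
    using G by (auto simp: finite_simple_graph_def)
  have finE: "finite E" using G by (rule finite_edges)
  let ?k = "largest_color_group E f"
  let ?m = "\<lambda>c. card (color_group E f c)"
  let ?n = "\<lambda>c. card (\<Union>(color_group E f c))"
  have bound: "sqrt 2 * ?m c \<le> sqrt ?k * ?n c" for c
  proof -
    have "\<Union>(color_group E f c) \<subseteq> V"
      using edge by (auto simp: color_group_def)
    then have "2 * ?m c \<le> (?n c)\<^sup>2"
      using finV edge by (intro two_card_edges_le) (auto simp: color_group_def intro: finite_subset)
    moreover have "?m c \<le> ?k"
      unfolding largest_color_group_def
      using finite_color_group_sizes[OF finE, of f] by (auto intro: Max_ge)
    ultimately have "?m c * (2 * ?m c) \<le> ?k * (?n c)\<^sup>2"
      by (rule mult_le_mono[rotated])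
    then have "real (?m c * (2 * ?m c)) \<le> real (?k * (?n c)\<^sup>2)"
      by (rule of_nat_mono)
    then have "2 * (real (?m c))\<^sup>2 \<le> real ?k * (real (?n c))\<^sup>2"
      by (simp add: power2_eq_square mult_ac)
    \<comment> \<open>Roots are taken color by color, since a bound linear in \<open>?m c\<close>
      and \<open>?n c\<close> can be summed.\<close>
    then have "sqrt (2 * (real (?m c))\<^sup>2) \<le> sqrt (real ?k * (real (?n c))\<^sup>2)"
      by (rule real_sqrt_le_mono)
    then show ?thesis by (simp add: real_sqrt_mult)
  qed
  have "card E = (\<Sum>c\<in>f ` E. ?m c)"
    using sum.image_gen[OF finE, of "\<lambda>_. 1 :: nat" f] by (simp add: color_group_def)
  then have "sqrt 2 * card E = (\<Sum>c\<in>f ` E. sqrt 2 * ?m c)"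
    by (simp add: sum_distrib_left)
  also have "\<dots> \<le> (\<Sum>c\<in>f ` E. sqrt ?k * ?n c)"
    by (intro sum_mono bound)
  also have "\<dots> = sqrt ?k * (\<Sum>c\<in>f ` E. ?n c)"
    by (simp add: sum_distrib_left)
  also have "\<dots> \<le> sqrt ?k * (q * card V)"
  proof -
    have "(\<Sum>c\<in>f ` E. ?n c) = (\<Sum>v\<in>V. card (f ` {e \<in> E. v \<in> e}))"
      using finV finE edge by (intro sum_card_Union_color_group) auto
    \<comment> \<open>The only use of the coloring condition: at most \<open>q\<close> colors meet
      at each vertex.\<close>
    also have "\<dots> \<le> (\<Sum>v\<in>V. q)"
      using col by (intro sum_mono) (simp add: edge_q_coloring_def)
    finally have "(\<Sum>c\<in>f ` E. ?n c) \<le> q * card V"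
      by (simp add: mult.commute)
    then have "real (\<Sum>c\<in>f ` E. ?n c) \<le> real (q * card V)"
      by (rule of_nat_mono)
    then show ?thesis by (intro mult_left_mono) simp_all
  qed
  finally show ?thesis .
qed

theorem theorem8:
  fixes V :: "'a set" and E :: "'a set set" and q :: nat
  assumes "q \<ge> 1"
    and "finite_simple_graph V E"
  shows "real (OPT q V E) \<ge> (average_degree V E)\<^sup>2 / (2 * (real q)\<^sup>2)"
proof (cases "card V = 0")
  \<comment> \<open>Division by 0 makes the average degree 0 here.\<close>
  case True
  then show ?thesis by (simp add: average_degree_def)
next
  case False
  obtain f :: "'a set \<Rightarrow> nat"
    where f: "edge_q_coloring q V E f" and opt: "largest_color_group E f = OPT q V E"
    using assms(1) by (rule OPT_attained)
  \<comment> \<open>For an optimal coloring, squaring removes the roots; dividing by the square of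
    \<open>q * card V\<close> then gives the claim.\<close>
  have "(sqrt 2 * card E)\<^sup>2 \<le> (sqrt (OPT q V E) * (q * card V))\<^sup>2"
    using card_edges_le_largest_color_group[OF assms(2) f] unfolding opt
    by (rule power_mono) simp
  then have "2 * (real (card E))\<^sup>2 \<le> OPT q V E * ((real q)\<^sup>2 * (real (card V))\<^sup>2)"
    by (simp add: power_mult_distrib)
  moreover have "real (card V) > 0" and "real q > 0"
    using False assms(1) by simp_all
  ultimately show ?thesis
    by (simp add: average_degree_def power_divide power_mult_distrib field_simps)
qed

end
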